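(* For every $r\in[0,1)$, the sequence $\big(\mathcal{C}_{n,r}(L^2_a,H^2)/\sqrt n\big)_{n\ge1}$ converges and $$\lim_{n\to\infty}\frac{\mathcal{C}_{n,r}(L^2_a,H^2)}{\sqrt n}=\sqrt{\frac{1+r}{1-r}}.$$
   Context: $\mathbb{D}$ is the open unit disc, $\hat f(k)$ is the $k$-th Taylor coefficient of $f$ holomorphic on $\mathbb{D}$. Hardy space: $H^2=\{f:\|f\|_{H^2}^2=\sum_{k\ge0}|\hat f(k)|^2<\infty\}$. Bergman space: $L^2_a=\{f:\|f\|_{L^2_a}^2=\frac1\pi\int_{\mathbb{D}}|f|^2\,dA=\sum_{k\ge0}\frac{|\hat f(k)|^2}{k+1}<\infty\}$. For $n\ge1$, $r\in[0,1)$, $\mathcal{R}_{n,r}$ is the set of rational functions $f=p/q$ where $q(z)=\prod_{j=1}^{n}(1-\overline{\lambda_j}z)$ with $|\lambda_j|\le r$, and $p$ a polynomial with $\deg p\le n-1$. For Banach spaces $X,Y$ of holomorphic functions on $\mathbb{D}$, $\mathcal{C}_{n,r}(X,Y)=\sup\{\|f'\|_X/\|f\|_Y: f\in\mathcal{R}_{n,r},\ f\neq0\}$. *)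

theory Defs
  imports "HOL-Analysis.Analysis" "HOL-Computational_Algebra.Polynomial_FPS"
begin

text \<open>Holomorphic functions on the disc are represented by their Taylor series at 0
  (formal power series of complex coefficients).\<close>

definition hardy_norm :: "complex fps \<Rightarrow> real" where
  "hardy_norm F = sqrt (\<Sum>k. (cmod (fps_nth F k))^2)"

definition bergman_norm :: "complex fps \<Rightarrow> real" where
  "bergman_norm F = sqrt (\<Sum>k. (cmod (fps_nth F k))^2 / real (k + 1))"

text \<open>The class R_{n,r}: p/q with q = prod (1 - conj(lambda_j) z), |lambda_j| <= r, deg p <= n-1,
  given through its Taylor expansion at 0 (q(0) = 1, so the division is well defined).\<close>

definition Rnr :: "nat \<Rightarrow> real \<Rightarrow> complex fps set" where
  "Rnr n r = {fps_of_poly p / fps_of_poly (\<Prod>j<n. [:1, - cnj (lam j):]) | p lam.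
      degree p \<le> n - 1 \<and> (\<forall>j<n. cmod (lam j) \<le> r)}"

definition C_bergman_hardy :: "nat \<Rightarrow> real \<Rightarrow> real" where
  "C_bergman_hardy n r =
     Sup {bergman_norm (fps_deriv f) / hardy_norm f | f. f \<in> Rnr n r \<and> f \<noteq> 0}"

end

theory Submission
  imports Defs "HOL-Complex_Analysis.Complex_Analysis" "HOL-Real_Asymp.Real_Asymp"
begin

text \<open>On the unit circle, \<open>\<parallel>f'\<parallel>\<^sup>2\<close> in the Bergman space is the mean \<open>D(f)\<close> of \<open>Re (z f' \<cdot> cnj f)\<close>.
  For \<open>f = p/q\<close> let \<open>g = P/q\<close>, where \<open>P = z\<^sup>n \<cdot> cnj p\<close> on the circle. Then \<open>D(f) + D(g)\<close> is
  the mean of \<open>W |f|\<^sup>2\<close>, where \<open>W\<close> is the sum of the Poisson kernels \<open>Re ((1 + w) / (1 - w))\<close>,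
  \<open>w = cnj \<lambda>\<^sub>j z\<close>, each at most \<open>(1 + r) / (1 - r)\<close>. As \<open>D(g) \<ge> 0\<close>, this gives the upper bound
  \<open>n (1 + r) / (1 - r)\<close> for the square of the constant.

  Conversely let all \<open>\<lambda>\<^sub>j\<close> equal \<open>r\<close> and \<open>f = b\<^sup>n\<^sup>-\<^sup>m (1 - r z)\<^sup>-\<^sup>m\<close> with \<open>b = (z - r) / (1 - r z)\<close> and
  \<open>m\<close> fixed. With \<open>N\<^sub>m\<close> the squared Hardy norm of \<open>(1 - r z)\<^sup>-\<^sup>m\<close> one gets \<open>\<parallel>f\<parallel>\<^sup>2 = N\<^sub>m\<close> and
  \<open>D(f) \<ge> (n - m) (1 - r\<^sup>2) N\<^sub>m\<^sub>+\<^sub>1 - m N\<^sub>m\<close>; since \<open>N\<^sub>m\<close> grows like \<open>(1 - r)\<^sup>-\<^sup>2\<^sup>m\<close>, the ratio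
  \<open>(1 - r\<^sup>2) N\<^sub>m\<^sub>+\<^sub>1 / N\<^sub>m\<close> comes as close to \<open>(1 + r) / (1 - r)\<close> as we like.\<close>

subsection \<open>Norms as integrals over the unit circle\<close>

lemma cis_in_conv_disc: "fps_conv_radius (f :: complex fps) > 1 \<Longrightarrow> ereal (cmod (cis t)) < fps_conv_radius f"
  by (simp add: one_ereal_def)

lemma continuous_on_eval_fps_cis:
  fixes f :: "complex fps"
  assumes "fps_conv_radius f > 1"
  shows "continuous_on A (\<lambda>t. eval_fps f (cis t))"
  using cis_in_conv_disc[OF assms] by (intro continuous_intros) auto

lemma has_integral_cis_int:
  "((\<lambda>t. cis (of_int m * t)) has_integral (if m = 0 then 2 * pi else 0)) {0..2*pi}"
proof (cases "m = 0")
  case True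
  then show ?thesis
    using has_integral_const_real[of "1::complex" 0 "2*pi"] by (simp add: scaleR_conv_of_real)
next
  case False
  have "((\<lambda>t. cis (of_int m * t)) has_integral
      (cis (of_int m * (2*pi)) / (\<i> * of_int m) - cis (of_int m * 0) / (\<i> * of_int m))) {0..2*pi}"
    using False
    by (intro fundamental_theorem_of_calculus)
       (auto simp: cis_conv_exp mult_ac has_real_derivative_iff_has_vector_derivative[symmetric]
             intro!: derivative_eq_intros has_vector_derivative_real_field)
  moreover have "cis (of_int m * (2*pi)) = 1"
    by (metis cis_multiple_2pi Ints_of_int mult.commute)
  ultimately show ?thesis
    using False by simp
qed

text \<open>A radius beyond 1 makes the coefficients absolutely summable, so by the Weierstrass
  M-test the series converges uniformly on the circle and integrates term by term. The weight
  \<open>h\<close> is arbitrary because Parseval needs it twice: as a conjugated character and as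
  the conjugate of a second series.\<close>

lemma sums_integral_eval_fps_cis:
  fixes f :: "complex fps" and h :: "real \<Rightarrow> complex"
  assumes f: "fps_conv_radius f > 1" and h: "continuous_on {a..b} h"
  shows "(\<lambda>k. fps_nth f k * integral {a..b} (\<lambda>t. cis (real k * t) * h t))
           sums integral {a..b} (\<lambda>t. eval_fps f (cis t) * h t)"
proof -
  have summ: "summable (\<lambda>k. cmod (fps_nth f k))"
    using norm_summable_fps[of 1 f] f by (simp add: one_ereal_def norm_mult)
  have "bounded (h ` {a..b})"
    using h compact_continuous_image compact_imp_bounded compact_Icc by blast
  then obtain B where B: "\<And>t. t \<in> {a..b} \<Longrightarrow> cmod (h t) \<le> B"
    unfolding bounded_iff by blast
  have "uniform_limit {a..b} (\<lambda>n t. \<Sum>k<n. fps_nth f k * (cis (real k * t) * h t))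
          (\<lambda>t. \<Sum>k. fps_nth f k * (cis (real k * t) * h t)) sequentially"
  proof (rule Weierstrass_m_test)
    show "norm (fps_nth f k * (cis (real k * t) * h t)) \<le> cmod (fps_nth f k) * B"
      if "t \<in> {a..b}" for k t
      using B[OF that] by (simp add: norm_mult mult_left_mono)
    show "summable (\<lambda>k. cmod (fps_nth f k) * B)"
      using summ by (rule summable_mult2)
  qed
  moreover have "(\<Sum>k. fps_nth f k * (cis (real k * t) * h t)) = eval_fps f (cis t) * h t" for t
  proof -
    have "(\<lambda>k. fps_nth f k * cis t ^ k * h t) sums (eval_fps f (cis t) * h t)"
      by (intro sums_mult2 sums_eval_fps cis_in_conv_disc f)
    then show ?thesis
      by (simp add: Complex.DeMoivre sums_iff mult.assoc)
  qed
  ultimately have "uniform_limit {a..b} (\<lambda>n t. \<Sum>k<n. fps_nth f k * (cis (real k * t) * h t))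
          (\<lambda>t. eval_fps f (cis t) * h t) sequentially"
    by simp
  then obtain I J where I: "\<And>n. ((\<lambda>t. \<Sum>k<n. fps_nth f k * (cis (real k * t) * h t)) has_integral I n) {a..b}"
    and J: "((\<lambda>t. eval_fps f (cis t) * h t) has_integral J) {a..b}" "I \<longlonglongrightarrow> J"
    by (rule uniform_limit_integral) (auto intro!: continuous_intros h)
  have "I n = (\<Sum>k<n. fps_nth f k * integral {a..b} (\<lambda>t. cis (real k * t) * h t))" for n
  proof (rule has_integral_unique[OF I])
    have "(\<lambda>t. cis (real k * t) * h t) integrable_on {a..b}" for k
      by (intro integrable_continuous_interval continuous_intros h)
    then show "((\<lambda>t. \<Sum>k<n. fps_nth f k * (cis (real k * t) * h t)) has_integral
        (\<Sum>k<n. fps_nth f k * integral {a..b} (\<lambda>t. cis (real k * t) * h t))) {a..b}"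
      by (intro has_integral_sum has_integral_mult_right) auto
  qed
  then have "I = (\<lambda>n. \<Sum>k<n. fps_nth f k * integral {a..b} (\<lambda>t. cis (real k * t) * h t))"
    by blast
  with J show ?thesis
    by (simp add: sums_def integral_unique)
qed

text \<open>Two termwise integrations: against \<open>cnj (cis (real k * t))\<close>, orthogonality
  isolates the coefficients of \<open>g\<close>; expanding \<open>f\<close> against the conjugate of
  \<open>g\<close> then leaves the conjugates of these coefficients.\<close>

lemma parseval_fps:
  fixes f g :: "complex fps"
  assumes f: "fps_conv_radius f > 1" and g: "fps_conv_radius g > 1"
  shows "(\<lambda>k. 2 * pi * (fps_nth f k * cnj (fps_nth g k)))
           sums integral {0..2*pi} (\<lambda>t. eval_fps f (cis t) * cnj (eval_fps g (cis t)))"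
proof -
  have coeff: "integral {0..2*pi} (\<lambda>t. eval_fps g (cis t) * cnj (cis (real k * t))) = 2 * pi * fps_nth g k" for k
  proof -
    have "integral {0..2*pi} (\<lambda>t. cis (real j * t) * cnj (cis (real k * t))) = (if j = k then 2 * pi else 0)" for j
    proof -
      have "(\<lambda>t. cis (real j * t) * cnj (cis (real k * t))) = (\<lambda>t. cis (of_int (int j - int k) * t))"
        by (simp add: cis_cnj cis_mult algebra_simps)
      then show ?thesis
        using has_integral_cis_int[of "int j - int k"] by (simp add: integral_unique)
    qed
    then have "(\<lambda>j. fps_nth g j * (if j = k then 2 * pi else 0)) sums
      integral {0..2*pi} (\<lambda>t. eval_fps g (cis t) * cnj (cis (real k * t)))"
      using sums_integral_eval_fps_cis[OF g, of 0 "2*pi" "\<lambda>t. cnj (cis (real k * t))"]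
      by (simp add: continuous_intros)
    moreover have "(\<lambda>j. fps_nth g j * (if j = k then 2 * pi else 0)) sums (fps_nth g k * (2 * pi))"
      using sums_single[of k "\<lambda>j. fps_nth g j * (2 * pi)"]
      by (rule back_subst[where P = "\<lambda>s. s sums _"]) auto
    ultimately show ?thesis
      by (simp add: sums_iff mult.commute)
  qed
  have "integral {0..2*pi} (\<lambda>t. cis (real k * t) * cnj (eval_fps g (cis t))) = 2 * pi * cnj (fps_nth g k)" for k
  proof -
    have "integral {0..2*pi} (\<lambda>t. cis (real k * t) * cnj (eval_fps g (cis t))) =
      cnj (integral {0..2*pi} (\<lambda>t. eval_fps g (cis t) * cnj (cis (real k * t))))"
      by (subst integral_cnj) (simp add: mult.commute)
    then show ?thesis
      by (simp add: coeff)
  qed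
  then show ?thesis
    using sums_integral_eval_fps_cis[OF f, of 0 "2*pi" "\<lambda>t. cnj (eval_fps g (cis t))"]
    by (simp add: continuous_on_eval_fps_cis[OF g] continuous_intros mult_ac)
qed

lemma
  assumes f: "fps_conv_radius f > 1"
  shows hardy_norm_integral: "((\<lambda>t. (cmod (eval_fps f (cis t)))\<^sup>2) has_integral 2 * pi * (hardy_norm f)\<^sup>2) {0..2*pi}"
    and summable_hardy: "summable (\<lambda>k. (cmod (fps_nth f k))\<^sup>2)"
proof -
  let ?F = "\<lambda>t. (cmod (eval_fps f (cis t)))\<^sup>2"
  have cont: "?F integrable_on {0..2*pi}"
    by (intro integrable_continuous_interval continuous_intros continuous_on_eval_fps_cis f)
  then have "((\<lambda>t. complex_of_real (?F t)) has_integral of_real (integral {0..2*pi} ?F)) {0..2*pi}"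
    by (intro has_integral_of_real) (rule integrable_integral)
  then have "(\<lambda>k. complex_of_real (2 * pi * (cmod (fps_nth f k))\<^sup>2)) sums of_real (integral {0..2*pi} ?F)"
    using parseval_fps[OF f f] by (simp add: integral_unique complex_norm_square[symmetric] del: of_real_power)
  then have *: "(\<lambda>k. 2 * pi * (cmod (fps_nth f k))\<^sup>2) sums integral {0..2*pi} ?F"
    by (simp only: sums_of_real_iff)
  then have "(\<lambda>k. (cmod (fps_nth f k))\<^sup>2) sums (integral {0..2*pi} ?F / (2 * pi))"
    using sums_divide[OF *, of "2 * pi"] by simp
  then show summ: "summable (\<lambda>k. (cmod (fps_nth f k))\<^sup>2)"
    by (simp add: sums_iff)
  have "2 * pi * (hardy_norm f)\<^sup>2 = integral {0..2*pi} ?F"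
    using * summ by (simp add: sums_iff hardy_norm_def suminf_nonneg suminf_mult)
  then show "(?F has_integral 2 * pi * (hardy_norm f)\<^sup>2) {0..2*pi}"
    using cont by (simp add: integrable_integral)
qed

text \<open>Parseval for \<open>z f'\<close> and \<open>f\<close> yields the sum of
  \<open>k |f_k|^2\<close>. This is the Bergman sum of \<open>f'\<close>, whose k-th coefficient is
  \<open>(k + 1) f_(k+1)\<close>.\<close>

lemma
  assumes f: "fps_conv_radius f > 1"
  shows bergman_norm_deriv_integral: "((\<lambda>t. Re (cis t * eval_fps (fps_deriv f) (cis t) * cnj (eval_fps f (cis t))))
           has_integral 2 * pi * (bergman_norm (fps_deriv f))\<^sup>2) {0..2*pi}"
    and bergman_norm_deriv_nonneg: "bergman_norm (fps_deriv f) \<ge> 0"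
proof -
  have f': "fps_conv_radius (fps_deriv f) > 1"
    using f fps_conv_radius_deriv[of f] by order
  let ?G = "\<lambda>t. cis t * eval_fps (fps_deriv f) (cis t) * cnj (eval_fps f (cis t))"
  have cont: "?G integrable_on {0..2*pi}"
    by (intro integrable_continuous_interval continuous_intros continuous_on_eval_fps_cis f f')
  define h where "h = fps_X * fps_deriv f"
  have h: "fps_conv_radius h > 1"
    using fps_conv_radius_mult[of fps_X "fps_deriv f"] f' unfolding h_def by auto
  have "eval_fps h (cis t) = cis t * eval_fps (fps_deriv f) (cis t)" for t
    unfolding h_def by (subst eval_fps_mult) (use cis_in_conv_disc[OF f'] in auto)
  then have "(\<lambda>k. 2 * pi * (fps_nth h k * cnj (fps_nth f k))) sums integral {0..2*pi} ?G"
    using parseval_fps[OF h f] by simp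
  moreover have "fps_nth h k = of_nat k * fps_nth f k" for k
    unfolding h_def by (cases k) (auto simp: fps_X_mult_nth)
  ultimately have "(\<lambda>k. complex_of_real (2 * pi * (real k * (cmod (fps_nth f k))\<^sup>2))) sums integral {0..2*pi} ?G"
    by (simp add: complex_norm_square mult_ac del: of_real_power)
  then have "(\<lambda>k. 2 * pi * (real k * (cmod (fps_nth f k))\<^sup>2)) sums Re (integral {0..2*pi} ?G)"
    using sums_Re by fastforce
  from sums_divide[OF this, of "2 * pi"]
  have "(\<lambda>k. real k * (cmod (fps_nth f k))\<^sup>2) sums (Re (integral {0..2*pi} ?G) / (2 * pi))"
    by simp
  \<comment> \<open>The term at index 0 vanishes, so the index shift loses nothing.\<close>
  then have "(\<lambda>k. real (Suc k) * (cmod (fps_nth f (Suc k)))\<^sup>2) sums (Re (integral {0..2*pi} ?G) / (2 * pi))"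
    by (subst sums_Suc_iff) simp
  moreover have "real (Suc k) * (cmod (fps_nth f (Suc k)))\<^sup>2 = (cmod (fps_nth (fps_deriv f) k))\<^sup>2 / real (k + 1)" for k
    by (simp add: norm_mult power_mult_distrib power2_eq_square del: of_nat_Suc)
  ultimately have "(\<lambda>k. (cmod (fps_nth (fps_deriv f) k))\<^sup>2 / real (k + 1)) sums (Re (integral {0..2*pi} ?G) / (2 * pi))"
    by simp
  then have summable: "summable (\<lambda>k. (cmod (fps_nth (fps_deriv f) k))\<^sup>2 / real (k + 1))"
    and suminf: "(\<Sum>k. (cmod (fps_nth (fps_deriv f) k))\<^sup>2 / real (k + 1)) = Re (integral {0..2*pi} ?G) / (2 * pi)"
    by (simp_all only: sums_iff)
  have nonneg: "0 \<le> (\<Sum>k. (cmod (fps_nth (fps_deriv f) k))\<^sup>2 / real (k + 1))"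
    using summable by (rule suminf_nonneg) simp
  then show "bergman_norm (fps_deriv f) \<ge> 0"
    unfolding bergman_norm_def by (rule real_sqrt_ge_zero)
  have "2 * pi * (bergman_norm (fps_deriv f))\<^sup>2 = Re (integral {0..2*pi} ?G)"
    unfolding bergman_norm_def real_sqrt_pow2[OF nonneg] by (simp only: suminf) simp
  then show "((\<lambda>t. Re (?G t)) has_integral 2 * pi * (bergman_norm (fps_deriv f))\<^sup>2) {0..2*pi}"
    using has_integral_Re[OF integrable_integral[OF cont]] by (simp only:)
qed

section \<open>Positivity and point evaluation in the Hardy space\<close>

lemma hardy_norm_nonneg: "hardy_norm f \<ge> 0" if "fps_conv_radius f > 1"
  using suminf_nonneg[OF summable_hardy[OF that]] by (simp add: hardy_norm_def)

lemma fps_nth_le_hardy_norm: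
  assumes f: "fps_conv_radius f > 1"
  shows "cmod (fps_nth f k) \<le> hardy_norm f"
proof -
  have "(cmod (fps_nth f k))\<^sup>2 \<le> (\<Sum>k. (cmod (fps_nth f k))\<^sup>2)"
    using sum_le_suminf[OF summable_hardy[OF f], of "{k}"] by simp
  then show ?thesis
    unfolding hardy_norm_def by (rule real_le_rsqrt)
qed

lemma hardy_norm_pos:
  assumes f: "fps_conv_radius f > 1" and "f \<noteq> 0"
  shows "hardy_norm f > 0"
proof -
  obtain k where "fps_nth f k \<noteq> 0"
    using \<open>f \<noteq> 0\<close> by (metis fps_nonzero_nth)
  then have "0 < cmod (fps_nth f k)" by simp
  also have "\<dots> \<le> hardy_norm f"
    by (rule fps_nth_le_hardy_norm[OF f])
  finally show ?thesis .
qed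

text \<open>Every coefficient is at most the norm, and a geometric series does the rest. The factor
  only has to be independent of \<open>f\<close>: in the growth argument below it is beaten by an
  m-th power.\<close>

lemma eval_fps_le_hardy_norm:
  assumes f: "fps_conv_radius f > 1" and z: "cmod z < 1"
  shows "cmod (eval_fps f z) \<le> hardy_norm f / (1 - cmod z)"
proof -
  have geo: "(\<lambda>k. hardy_norm f * cmod z ^ k) sums (hardy_norm f * (1 / (1 - cmod z)))"
    using z by (intro sums_mult geometric_sums) auto
  have "cmod (eval_fps f z) = cmod (\<Sum>k. fps_nth f k * z ^ k)"
    by (simp add: eval_fps_def)
  also have "\<dots> \<le> (\<Sum>k. hardy_norm f * cmod z ^ k)"
    using geo by (intro norm_suminf_le)
      (auto simp: norm_mult norm_power sums_iff intro!: mult_right_mono fps_nth_le_hardy_norm[OF f])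
  also have "\<dots> = hardy_norm f / (1 - cmod z)"
    using geo by (simp add: sums_iff)
  finally show ?thesis .
qed

subsection \<open>Rational functions on the circle\<close>

lemma
  fixes p q :: "complex poly"
  assumes R: "R > 0" and nz: "\<And>z. cmod z < R \<Longrightarrow> poly q z \<noteq> 0"
  shows fps_conv_radius_rational: "fps_conv_radius (fps_of_poly p / fps_of_poly q) \<ge> ereal R"
    and eval_fps_rational: "cmod z < R \<Longrightarrow> eval_fps (fps_of_poly p / fps_of_poly q) z = poly p z / poly q z"
proof -
  have nz': "eval_fps (fps_of_poly q) z \<noteq> 0" if "z \<in> eball 0 (ereal R)" for z
    using nz that by simp
  show "fps_conv_radius (fps_of_poly p / fps_of_poly q) \<ge> ereal R"
    using fps_conv_radius_divide'[where r = "ereal R" and g = "fps_of_poly q" and f = "fps_of_poly p", OF _ _ _ nz'] R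
    by simp
  show "eval_fps (fps_of_poly p / fps_of_poly q) z = poly p z / poly q z" if "cmod z < R"
    using eval_fps_divide'[where r = "ereal R" and g = "fps_of_poly q" and f = "fps_of_poly p", OF _ _ _ nz'] R that
    by simp
qed

lemma eval_fps_deriv_rational:
  fixes p q :: "complex poly"
  assumes R: "R > 0" and nz: "\<And>z. cmod z < R \<Longrightarrow> poly q z \<noteq> 0" and z: "cmod z < R"
  shows "eval_fps (fps_deriv (fps_of_poly p / fps_of_poly q)) z =
          (poly (pderiv p) z * poly q z - poly p z * poly (pderiv q) z) / (poly q z)\<^sup>2"
proof -
  \<comment> \<open>A nonzero constant term makes \<open>q\<close> a unit among the power series, so
    the formal quotient rule applies.\<close>
  have "coeff q 0 \<noteq> 0"
    using nz[of 0] R by (simp add: poly_0_coeff_0)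
  then have "is_unit (fps_of_poly q)"
    by (simp add: fps_is_unit_iff)
  then have "fps_of_poly q dvd fps_of_poly p"
    by (rule unit_imp_dvd)
  then have "fps_deriv (fps_of_poly p / fps_of_poly q)
      = fps_of_poly (pderiv p * q - p * pderiv q) / fps_of_poly (q ^ 2)"
    by (simp only: fps_divide_deriv fps_of_poly_pderiv fps_of_poly_diff fps_of_poly_mult fps_of_poly_power)
  moreover have nz2: "poly (q ^ 2) z \<noteq> 0" if "cmod z < R" for z
    using nz[OF that] by simp
  ultimately show ?thesis
    using eval_fps_rational[OF R nz2 z, of "pderiv p * q - p * pderiv q"]
    by (simp only: poly_power poly_mult poly_diff)
qed

text \<open>For \<open>degree p < n\<close> this is \<open>z^n\<close> times the conjugate of
  \<open>p (1 / cnj z)\<close>. The exponents run from 1 to \<open>n\<close>; reflecting with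
  \<open>z^n\<close> is what makes \<open>n - 2 Re (z q' / q)\<close> appear later, one unit for
  each factor of \<open>q\<close>.\<close>

definition conj_reverse :: "nat \<Rightarrow> complex poly \<Rightarrow> complex poly" where
  "conj_reverse n p = (\<Sum>i<n. monom (cnj (coeff p i)) (n - i))"

lemma power_diff_unit_circle:
  assumes "cmod z = 1" "i \<le> n"
  shows "z ^ (n - i) = z ^ n * cnj (z ^ i)"
proof -
  have "z ^ n * cnj (z ^ i) = z ^ (n - i) * (z * cnj z) ^ i"
    using assms(2) by (simp add: power_mult_distrib flip: power_add mult.assoc)
  then show ?thesis
    using assms(1) by (simp add: complex_norm_square[symmetric])
qed

lemma poly_eq_sum_lessThan:
  fixes p :: "complex poly"
  assumes "degree p < n"
  shows "poly p z = (\<Sum>i<n. coeff p i * z ^ i)"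
  unfolding poly_altdef using assms by (auto intro!: sum.mono_neutral_left simp: coeff_eq_0 le_degree)

lemma poly_pderiv_eq_sum_lessThan:
  fixes p :: "complex poly"
  assumes "degree p < n"
  shows "z * poly (pderiv p) z = (\<Sum>i<n. of_nat i * coeff p i * z ^ i)"
proof -
  \<comment> \<open>Multiplying by the variable restores the degree lost by \<open>pderiv\<close>; a
    constant \<open>p\<close> is set apart because there the product is the zero polynomial.\<close>
  have "degree (pCons 0 (pderiv p)) < n \<or> pderiv p = 0"
    using assms by (auto simp: degree_pderiv pderiv_eq_0_iff)
  then have "degree (pCons 0 (pderiv p)) < n"
    using assms by auto
  moreover have "coeff (pCons 0 (pderiv p)) i = of_nat i * coeff p i" for i
    by (cases i) (simp_all add: coeff_pderiv)
  ultimately show ?thesis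
    using poly_eq_sum_lessThan[of "pCons 0 (pderiv p)" n z] by simp
qed

text \<open>On the circle \<open>z^(n-i)\<close> equals \<open>z^n * cnj (z^i)\<close>. The operator
  \<open>z d/dz\<close> multiplies it by \<open>n - i\<close>, whose two parts give
  \<open>n * cnj p\<close> and the conjugate of \<open>z p'\<close>.\<close>

lemma
  assumes p: "degree p < n" and z: "cmod z = 1"
  shows poly_conj_reverse: "poly (conj_reverse n p) z = z ^ n * cnj (poly p z)"
    and poly_pderiv_conj_reverse: "z * poly (pderiv (conj_reverse n p)) z =
          z ^ n * (of_nat n * cnj (poly p z) - cnj (z * poly (pderiv p) z))"
proof -
  show "poly (conj_reverse n p) z = z ^ n * cnj (poly p z)"
    by (simp add: conj_reverse_def poly_sum poly_monom power_diff_unit_circle[OF z]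
        poly_eq_sum_lessThan[OF p] sum_distrib_left mult_ac)
  have "z * poly (pderiv (conj_reverse n p)) z = (\<Sum>i<n. of_nat (n - i) * cnj (coeff p i) * (z * z ^ (n - i - 1)))"
    by (simp add: conj_reverse_def higher_pderiv_sum[of 1, simplified] poly_sum pderiv_monom poly_monom
        sum_distrib_left mult_ac)
  also have "\<dots> = (\<Sum>i<n. z ^ n * ((of_nat n - of_nat i) * cnj (coeff p i) * cnj (z ^ i)))"
    by (intro sum.cong refl) (simp add: power_diff_unit_circle[OF z, symmetric] of_nat_diff mult_ac Suc_diff_Suc
        flip: power_Suc complex_cnj_power)
  also have "\<dots> = z ^ n * (of_nat n * cnj (poly p z) - cnj (z * poly (pderiv p) z))"
    unfolding poly_eq_sum_lessThan[OF p] poly_pderiv_eq_sum_lessThan[OF p]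
    by (simp add: sum_distrib_left sum_subtractf algebra_simps)
  finally show "z * poly (pderiv (conj_reverse n p)) z =
          z ^ n * (of_nat n * cnj (poly p z) - cnj (z * poly (pderiv p) z))" .
qed

text \<open>Here \<open>a, b, a', b'\<close> stand for \<open>p, q, z p', z q'\<close> at a point \<open>z\<close> of the circle,
  and \<open>w\<close> for \<open>z\<^sup>n\<close>: the cross terms of \<open>p/q\<close> and of its reflection are purely imaginary in sum.\<close>

lemma Re_logderiv_add_reverse:
  fixes a a' b b' w :: complex and n :: nat
  assumes b: "b \<noteq> 0" and w: "cmod w = 1"
  defines "u \<equiv> w * cnj a" and "u' \<equiv> w * (of_nat n * cnj a - cnj a')"
  shows "Re ((a' * b - a * b') / b\<^sup>2 * cnj (a / b)) + Re ((u' * b - u * b') / b\<^sup>2 * cnj (u / b))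
           = (real n - 2 * Re (b' / b)) * (cmod (a / b))\<^sup>2"
proof -
  have ww: "w * cnj w = 1"
    using w by (simp add: complex_norm_square[symmetric])
  have "(a' * b - a * b') / b\<^sup>2 * cnj (a / b) + (u' * b - u * b') / b\<^sup>2 * cnj (u / b)
      = (of_nat n - 2 * (b' / b)) * (a / b * cnj (a / b)) + (a' * cnj a - cnj (a' * cnj a)) / (b * cnj b)"
  proof -
    \<comment> \<open>The conjugates become independent variables \<open>A\<close>,
      \<open>A'\<close>, \<open>B\<close>, so that only a rational identity remains.\<close>
    have "(a' * b - a * b') / b\<^sup>2 * (A / B) + ((of_nat n * A - A') * b - A * b') / b\<^sup>2 * (a / B)
        = (of_nat n - 2 * (b' / b)) * (a / b * (A / B)) + (a' * A - A' * a) / (b * B)"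
      if "B \<noteq> 0" for A A' B
      using b that by (simp add: field_simps power2_eq_square)
    from this[of "cnj b" "cnj a" "cnj a'"]
    have "(a' * b - a * b') / b\<^sup>2 * cnj (a / b) + ((of_nat n * cnj a - cnj a') * b - cnj a * b') / b\<^sup>2 * (a / cnj b)
        = (of_nat n - 2 * (b' / b)) * (a / b * cnj (a / b)) + (a' * cnj a - cnj (a' * cnj a)) / (b * cnj b)"
      using b by simp
    moreover have "(u' * b - u * b') / b\<^sup>2 * cnj (u / b) =
       (w * cnj w) * (((of_nat n * cnj a - cnj a') * b - cnj a * b') / b\<^sup>2 * (a / cnj b))"
      by (simp add: u_def u'_def algebra_simps)
    ultimately show ?thesis
      by (simp only: ww mult_1_left)
  qed
  moreover have "Re ((a' * cnj a - cnj (a' * cnj a)) / (b * cnj b)) = 0"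
    by (simp add: complex_norm_square[symmetric] del: of_real_power)
  moreover have "Re ((of_nat n - 2 * (b' / b)) * (a / b * cnj (a / b))) = (real n - 2 * Re (b' / b)) * (cmod (a / b))\<^sup>2"
    by (subst complex_norm_square[symmetric]) (simp del: times_divide_eq_right)
  ultimately show ?thesis
    by (metis plus_complex.sel(1) add.right_neutral)
qed

section \<open>Poisson kernels from the denominator\<close>

lemma Re_cayley_le:
  assumes "cmod w \<le> r" "r < 1"
  shows "Re ((1 + w) / (1 - w)) \<le> (1 + r) / (1 - r)"
proof -
  have "Re ((1 + w) / (1 - w)) \<le> cmod (1 + w) / cmod (1 - w)"
    by (metis complex_Re_le_cmod norm_divide)
  also have "\<dots> \<le> (1 + r) / (1 - r)"
    using assms order_trans[OF norm_ge_zero assms(1)] norm_triangle_ineq[of 1 w] norm_triangle_ineq2[of 1 w]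
    by (intro frac_le) auto
  finally show ?thesis .
qed

text \<open>Logarithmic derivatives of a product add up, hence the induction. With
  \<open>w = cnj (lam j) * z\<close>, the factor \<open>1 - w\<close> contributes
  \<open>1 + 2 Re (w / (1 - w))\<close>, which is the Poisson kernel
  \<open>Re ((1 + w) / (1 - w))\<close>.\<close>

lemma Re_logderiv_prod_linear_le:
  fixes lam :: "nat \<Rightarrow> complex"
  assumes lam: "\<And>j. j < n \<Longrightarrow> cmod (lam j) \<le> r" and r: "r < 1" and z: "cmod z = 1"
  defines "q \<equiv> \<lambda>n. \<Prod>j<n. [:1, - cnj (lam j):]"
  shows "real n - 2 * Re (z * poly (pderiv (q n)) z / poly (q n) z) \<le> real n * ((1 + r) / (1 - r))"
  using lam
proof (induction n)
  case (Suc n)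
  define w where "w = cnj (lam n) * z"
  have "cmod w \<le> r"
    using Suc.prems[of n] z by (simp add: w_def norm_mult)
  then have w: "1 - w \<noteq> 0" and le: "Re ((1 + w) / (1 - w)) \<le> (1 + r) / (1 - r)"
    using r Re_cayley_le by auto
  have "poly (q n) z \<noteq> 0"
  proof -
    have "1 - z * cnj (lam j) \<noteq> 0" if "j < n" for j
    proof -
      have "cmod (z * cnj (lam j)) < 1"
        using Suc.prems[of j] that r z by (simp add: norm_mult)
      then show ?thesis by auto
    qed
    then show ?thesis
      by (simp add: q_def poly_prod)
  qed
  moreover have "q (Suc n) = q n * [:1, - cnj (lam n):]"
    by (simp only: q_def prod.lessThan_Suc)
  then have "poly (q (Suc n)) z = poly (q n) z * (1 - w)"
    and "z * poly (pderiv (q (Suc n))) z = z * poly (pderiv (q n)) z * (1 - w) - poly (q n) z * w"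
    by (simp_all only: pderiv_mult pderiv_pCons poly_mult poly_add) (simp_all add: w_def algebra_simps)
  ultimately have "z * poly (pderiv (q (Suc n))) z / poly (q (Suc n)) z =
      z * poly (pderiv (q n)) z / poly (q n) z - w / (1 - w)"
    using w by (simp add: diff_divide_distrib)
  moreover have "(1 + w) / (1 - w) = 1 + 2 * (w / (1 - w))"
    using w by (simp add: field_simps)
  then have "Re ((1 + w) / (1 - w)) = 1 + 2 * Re (w / (1 - w))"
    by (simp del: times_divide_eq_right)
  moreover have "real n - 2 * Re (z * poly (pderiv (q n)) z / poly (q n) z) \<le> real n * ((1 + r) / (1 - r))"
    using Suc by simp
  ultimately show ?case
    using le by (simp add: distrib_right del: times_divide_eq_right)
qed (simp add: q_def)

subsection \<open>The upper bound\<close>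

text \<open>The radius \<open>2 / (1 + r)\<close> exceeds 1 and, for \<open>r > 0\<close>, stays
  below \<open>1 / r\<close>; unlike \<open>1 / r\<close> it also makes sense for
  \<open>r = 0\<close>.\<close>

lemma Rnr_denominator:
  fixes lam :: "nat \<Rightarrow> complex"
  assumes r: "0 \<le> r" "r < 1" and lam: "\<And>j. j < n \<Longrightarrow> cmod (lam j) \<le> r" and z: "cmod z < 2 / (1 + r)"
  shows "poly (\<Prod>j<n. [:1, - cnj (lam j):]) z \<noteq> 0"
proof -
  have "1 - z * cnj (lam j) \<noteq> 0" if "j < n" for j
  proof -
    have "cmod (z * cnj (lam j)) \<le> 2 / (1 + r) * r"
      using lam[OF that] z r unfolding norm_mult by (intro mult_mono) auto
    also have "\<dots> < 1"
      using r by (simp add: field_simps)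
    finally show ?thesis by auto
  qed
  then show ?thesis
    by (simp add: poly_prod)
qed

lemma Rnr_conv_radius:
  assumes r: "0 \<le> r" "r < 1" and f: "f \<in> Rnr n r"
  shows "fps_conv_radius f > 1"
proof -
  have R: "1 < 2 / (1 + r)"
    using r by simp
  then have "ereal 1 < ereal (2 / (1 + r))"
    by simp
  also obtain p lam where f: "f = fps_of_poly p / fps_of_poly (\<Prod>j<n. [:1, - cnj (lam j):])"
    and lam: "\<forall>j<n. cmod (lam j) \<le> r"
    using f by (auto simp: Rnr_def)
  have "ereal (2 / (1 + r)) \<le> fps_conv_radius f"
    unfolding f using R by (intro fps_conv_radius_rational Rnr_denominator[OF r]) (use r lam in auto)
  finally show ?thesis
    by (simp add: one_ereal_def)
qed

lemma bergman_norm_deriv_le: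
  assumes r: "0 \<le> r" "r < 1" and n: "n \<ge> 1" and f: "f \<in> Rnr n r"
  shows "(bergman_norm (fps_deriv f))\<^sup>2 \<le> real n * ((1 + r) / (1 - r)) * (hardy_norm f)\<^sup>2"
proof -
  define R where "R = 2 / (1 + r)"
  have R: "R > 1" and R0: "R > 0"
    using r by (simp_all add: R_def)
  obtain p lam where f_def: "f = fps_of_poly p / fps_of_poly (\<Prod>j<n. [:1, - cnj (lam j):])"
    and lam: "\<And>j. j < n \<Longrightarrow> cmod (lam j) \<le> r" and p: "degree p \<le> n - 1"
    using f by (auto simp: Rnr_def)
  define q where "q = (\<Prod>j<n. [:1, - cnj (lam j):])"
  define P where "P = conj_reverse n p"
  define g where "g = fps_of_poly P / fps_of_poly q"
  have f_eq: "f = fps_of_poly p / fps_of_poly q"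
    by (simp add: f_def q_def)
  have nz: "poly q z \<noteq> 0" if "cmod z < R" for z
    unfolding q_def using r lam that by (intro Rnr_denominator) (auto simp: R_def)
  have "ereal R \<le> fps_conv_radius f" "ereal R \<le> fps_conv_radius g"
    unfolding f_eq g_def using fps_conv_radius_rational[OF R0 nz] by simp_all
  then have rad: "fps_conv_radius f > 1" "fps_conv_radius g > 1"
    using ereal_less_eq(3) R less_le_trans[of 1 "ereal R"] by (simp_all add: one_ereal_def)
  let ?D = "\<lambda>h t. Re (cis t * eval_fps (fps_deriv h) (cis t) * cnj (eval_fps h (cis t)))"
  have le: "?D f t + ?D g t \<le> real n * ((1 + r) / (1 - r)) * (cmod (eval_fps f (cis t)))\<^sup>2" for t
  proof -
    let ?z = "cis t"
    have z: "cmod ?z < R" and z1: "cmod ?z = 1" and zn: "cmod (?z ^ n) = 1"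
      using R by (auto simp: norm_power)
    have pn: "degree p < n"
      using p n by simp
    \<comment> \<open>The factor \<open>z\<close> is moved onto both derivatives, to match
      \<open>a' = z p'\<close> and \<open>b' = z q'\<close> in
      \<open>Re_logderiv_add_reverse\<close>.\<close>
    have D: "?D (fps_of_poly a / fps_of_poly q) t =
      Re ((?z * poly (pderiv a) ?z * poly q ?z - poly a ?z * (?z * poly (pderiv q) ?z)) / (poly q ?z)\<^sup>2
          * cnj (poly a ?z / poly q ?z))" for a
      using eval_fps_deriv_rational[OF R0 nz z, of a]
        eval_fps_rational[OF R0 nz z, of a]
      by (simp add: algebra_simps)
    have "?D f t + ?D g t = (real n - 2 * Re (?z * poly (pderiv q) ?z / poly q ?z)) * (cmod (poly p ?z / poly q ?z))\<^sup>2"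
      unfolding f_eq g_def D unfolding P_def poly_conj_reverse[OF pn z1] poly_pderiv_conj_reverse[OF pn z1]
      using nz[OF z] zn by (rule Re_logderiv_add_reverse)
    also have "\<dots> \<le> real n * ((1 + r) / (1 - r)) * (cmod (poly p ?z / poly q ?z))\<^sup>2"
      unfolding q_def using lam r z1 by (intro mult_right_mono Re_logderiv_prod_linear_le) auto
    also have "poly p ?z / poly q ?z = eval_fps f ?z"
      using eval_fps_rational[OF R0 nz z, of p] by (simp add: f_eq)
    finally show ?thesis .
  qed
  have int1: "((\<lambda>t. ?D f t + ?D g t) has_integral
      2 * pi * (bergman_norm (fps_deriv f))\<^sup>2 + 2 * pi * (bergman_norm (fps_deriv g))\<^sup>2) {0..2*pi}"
    by (intro has_integral_add bergman_norm_deriv_integral rad)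
  have int2: "((\<lambda>t. real n * ((1 + r) / (1 - r)) * (cmod (eval_fps f (cis t)))\<^sup>2) has_integral
      real n * ((1 + r) / (1 - r)) * (2 * pi * (hardy_norm f)\<^sup>2)) {0..2*pi}"
    by (intro has_integral_mult_right hardy_norm_integral rad)
  have "2 * pi * (bergman_norm (fps_deriv f))\<^sup>2 + 2 * pi * (bergman_norm (fps_deriv g))\<^sup>2
      \<le> real n * ((1 + r) / (1 - r)) * (2 * pi * (hardy_norm f)\<^sup>2)"
    using int1 int2 le by (rule has_integral_le)
  also have "\<dots> = 2 * pi * (real n * ((1 + r) / (1 - r)) * (hardy_norm f)\<^sup>2)"
    by simp
  finally have "(bergman_norm (fps_deriv f))\<^sup>2 + (bergman_norm (fps_deriv g))\<^sup>2
      \<le> real n * ((1 + r) / (1 - r)) * (hardy_norm f)\<^sup>2"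
    unfolding distrib_left[symmetric] by (rule mult_left_le_imp_le) simp
  then show ?thesis
    using zero_le_power2[of "bergman_norm (fps_deriv g)"] by linarith
qed

lemma bergman_hardy_ratio_le:
  assumes r: "0 \<le> r" "r < 1" and n: "n \<ge> 1" and f: "f \<in> Rnr n r" and "f \<noteq> 0"
  shows "bergman_norm (fps_deriv f) / hardy_norm f \<le> sqrt (real n * ((1 + r) / (1 - r)))"
proof -
  have "hardy_norm f > 0"
    using hardy_norm_pos[OF Rnr_conv_radius[OF r f]] \<open>f \<noteq> 0\<close> by blast
  then have "(bergman_norm (fps_deriv f) / hardy_norm f)\<^sup>2 \<le> real n * ((1 + r) / (1 - r))"
    using bergman_norm_deriv_le[OF r n f] by (simp add: power_divide pos_divide_le_eq)
  then show ?thesis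
    by (rule real_le_rsqrt)
qed

subsection \<open>The lower bound\<close>

text \<open>For \<open>m = 1\<close> this is the Szego kernel, the reproducing kernel of the Hardy
  space, at the point \<open>r\<close>.\<close>

definition szego_power :: "real \<Rightarrow> nat \<Rightarrow> complex fps" where
  "szego_power r m = fps_of_poly 1 / fps_of_poly ([:1, - of_real r:] ^ m)"

text \<open>With \<open>b(z) = (z - r) / (1 - r z)\<close>, this is \<open>b\<^sup>k\<close> times \<open>szego_power r m\<close>;
  since \<open>b\<close> is unimodular on the circle, the two have the same modulus there.\<close>

definition blaschke_szego :: "real \<Rightarrow> nat \<Rightarrow> nat \<Rightarrow> complex fps" where
  "blaschke_szego r k m = fps_of_poly ([:- of_real r, 1:] ^ k) / fps_of_poly ([:1, - of_real r:] ^ (k + m))"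

text \<open>The logarithmic form avoids the exponent \<open>n - 1\<close> and covers
  \<open>n = 0\<close>.\<close>

lemma poly_pderiv_linear_power:
  fixes a b z :: complex
  assumes "a + z * b \<noteq> 0"
  shows "poly (pderiv ([:a, b:] ^ n)) z = poly ([:a, b:] ^ n) z * (of_nat n * (b / (a + z * b)))"
proof (cases n)
  case (Suc k)
  have "poly (pderiv ([:a, b:] ^ Suc k)) z = of_nat (Suc k) * (a + z * b) ^ k * b"
    unfolding pderiv_power_Suc by (simp add: pderiv_pCons poly_power)
  moreover have "poly ([:a, b:] ^ Suc k) z = (a + z * b) ^ k * (a + z * b)"
    by (simp add: poly_power del: power_Suc) simp
  ultimately show ?thesis
    using assms Suc by simp
qed simp

context
  fixes r :: real
  assumes r: "0 \<le> r" "r < 1"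
begin

lemma szego_denominator_nonzero: "cmod z < 2 / (1 + r) \<Longrightarrow> poly ([:1, - of_real r:] ^ n) z \<noteq> 0"
  using Rnr_denominator[OF r, of n "\<lambda>_. of_real r" z] r by (simp add: poly_power)

lemma szego_radius: "2 / (1 + r) > 0" "2 / (1 + r) > 1"
  using r by (simp_all add: field_simps)

lemma conv_radius_over_denominator:
  fixes p :: "complex poly"
  shows "fps_conv_radius (fps_of_poly p / fps_of_poly ([:1, - of_real r:] ^ n)) \<ge> ereal (2 / (1 + r))"
  by (rule fps_conv_radius_rational[OF szego_radius(1) szego_denominator_nonzero])

lemma
  assumes "cmod z < 2 / (1 + r)"
  shows eval_over_denominator: "eval_fps (fps_of_poly p / fps_of_poly ([:1, - of_real r:] ^ n)) z
          = poly p z / poly ([:1, - of_real r:] ^ n) z"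
    and eval_deriv_over_denominator: "eval_fps (fps_deriv (fps_of_poly p / fps_of_poly ([:1, - of_real r:] ^ n))) z
          = (poly (pderiv p) z * poly ([:1, - of_real r:] ^ n) z - poly p z * poly (pderiv ([:1, - of_real r:] ^ n)) z)
            / (poly ([:1, - of_real r:] ^ n) z)\<^sup>2"
  by (rule eval_fps_rational[OF szego_radius(1) szego_denominator_nonzero assms]; assumption)
     (rule eval_fps_deriv_rational[OF szego_radius(1) szego_denominator_nonzero assms]; assumption)

text \<open>The numerator has degree \<open>k\<close> and the class admits \<open>k + m - 1\<close>;
  this is where \<open>m \<ge> 1\<close> enters.\<close>

lemma blaschke_szego_in_Rnr:
  assumes "m \<ge> 1"
  shows "blaschke_szego r k m \<in> Rnr (k + m) r"
proof -
  have "degree ([:- of_real r, 1:] ^ k :: complex poly) \<le> k + m - 1"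
    using degree_power_le[of "[:- of_real r, 1:] :: complex poly" k] assms by simp
  moreover have "[:1, - of_real r:] ^ (k + m) = (\<Prod>j<k + m. [:1, - cnj (of_real r):])"
    by simp
  ultimately show ?thesis
    unfolding Rnr_def blaschke_szego_def using r
    by (intro CollectI exI[of _ "[:- of_real r, 1:] ^ k"] exI[of _ "\<lambda>_. of_real r"]) simp
qed

lemma conv_radius_szego_power: "fps_conv_radius (szego_power r m) > 1"
proof -
  have "ereal 1 < ereal (2 / (1 + r))"
    using szego_radius by simp
  also have "\<dots> \<le> fps_conv_radius (szego_power r m)"
    unfolding szego_power_def by (rule conv_radius_over_denominator)
  finally show ?thesis
    by (simp add: one_ereal_def)
qed

lemma conv_radius_blaschke_szego: "fps_conv_radius (blaschke_szego r k m) > 1"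
proof -
  have "ereal 1 < ereal (2 / (1 + r))"
    using szego_radius by simp
  also have "\<dots> \<le> fps_conv_radius (blaschke_szego r k m)"
    unfolding blaschke_szego_def by (rule conv_radius_over_denominator)
  finally show ?thesis
    by (simp add: one_ereal_def)
qed

lemma eval_szego_power:
  assumes "cmod z < 2 / (1 + r)"
  shows "eval_fps (szego_power r m) z = 1 / (1 - of_real r * z) ^ m"
  unfolding szego_power_def eval_over_denominator[OF assms]
  by (simp add: poly_power mult.commute)

lemma hardy_norm_szego_power_pos: "hardy_norm (szego_power r m) > 0"
proof (rule hardy_norm_pos[OF conv_radius_szego_power])
  show "szego_power r m \<noteq> 0"
    using eval_szego_power[of 0 m] szego_radius by (auto simp: eval_fps_at_0)
qed

section \<open>The test functions at a point of the unit circle\<close>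

context
  fixes z d :: complex
  assumes z: "cmod z = 1" and d: "d = 1 - of_real r * z"
begin

lemma szego_factor_nonzero: "d \<noteq> 0"
proof -
  have "cmod (of_real r * z) < 1"
    using z r by (simp add: norm_mult)
  then show ?thesis
    using d by auto
qed

text \<open>On the circle \<open>1 / z = cnj z\<close>. Hence \<open>z - r\<close> and
  \<open>d\<close> have the same modulus, that is, the Blaschke factor is unimodular.\<close>

lemma numerator_factor_eq: "z - of_real r = z * cnj d"
proof -
  have "z * cnj z = 1"
    using z by (simp add: complex_norm_square[symmetric])
  then show ?thesis
    by (simp add: d algebra_simps)
qed

text \<open>From \<open>2 Re d = |d|^2 + (1 - r^2)\<close> on the circle. So
  \<open>2 Re (1 / d) - 1\<close> is the Poisson kernel at \<open>r\<close>; its factor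
  \<open>|d|^(-2)\<close> later turns the m-th Szego power into the next one.\<close>

lemma Re_inverse_szego_factor: "2 * Re (1 / d) = 1 + (1 - r\<^sup>2) / (cmod d)\<^sup>2"
proof -
  have "(Re z)\<^sup>2 + (Im z)\<^sup>2 = 1"
    using z by (simp add: cmod_def)
  then have "2 * Re d = (cmod d)\<^sup>2 + (1 - r\<^sup>2)"
    unfolding cmod_power2 by (simp add: d algebra_simps power2_eq_square flip: distrib_left)
  moreover have "Re (1 / d) = Re d / (cmod d)\<^sup>2"
    by (simp add: Re_divide cmod_power2)
  ultimately show ?thesis
    using szego_factor_nonzero by (simp add: field_simps)
qed

lemma circle_in_disc: "cmod z < 2 / (1 + r)"
  using z szego_radius by simp

lemma cmod_eval_blaschke_szego: "cmod (eval_fps (blaschke_szego r k m) z) = 1 / cmod d ^ m"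
proof -
  have "eval_fps (blaschke_szego r k m) z = (z - of_real r) ^ k / d ^ (k + m)"
    unfolding blaschke_szego_def eval_over_denominator[OF circle_in_disc]
    by (simp add: poly_power d mult.commute)
  then show ?thesis
    using z szego_factor_nonzero by (simp add: numerator_factor_eq norm_divide norm_mult norm_power power_add)
qed

text \<open>Logarithmic differentiation: each numerator factor gives
  \<open>z / (z - r) = 1 / cnj d\<close>, each denominator factor
  \<open>r z / d = 1 / d - 1\<close>.\<close>

lemma eval_deriv_blaschke_szego:
  "z * eval_fps (fps_deriv (blaschke_szego r k m)) z =
     eval_fps (blaschke_szego r k m) z * (of_nat k / cnj d + of_nat (k + m) * (1 / d - 1))"
proof -
  let ?p = "[:- of_real r, 1:] ^ k :: complex poly" and ?q = "[:1, - of_real r:] ^ (k + m) :: complex poly"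
  have z0: "z \<noteq> 0"
    using z by auto
  have s0: "z - of_real r \<noteq> 0"
    using numerator_factor_eq z0 szego_factor_nonzero by simp
  have p: "z * poly (pderiv ?p) z = poly ?p z * (of_nat k / cnj d)"
  proof -
    have "z / (z - of_real r) = 1 / cnj d"
      using z0 szego_factor_nonzero by (simp add: numerator_factor_eq)
    moreover have "z * poly (pderiv ?p) z = poly ?p z * (of_nat k * (z / (z - of_real r)))"
      using s0 poly_pderiv_linear_power[of "- of_real r" z 1 k] by (simp add: mult_ac)
    ultimately show ?thesis
      by simp
  qed
  have q: "z * poly (pderiv ?q) z = - poly ?q z * (of_nat (k + m) * (1 / d - 1))"
  proof -
    have "1 / d - 1 = of_real r * z / d"
      using szego_factor_nonzero by (simp add: d field_simps)
    moreover have "z * poly (pderiv ?q) z = - poly ?q z * (of_nat (k + m) * (of_real r * z / d))"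
      using szego_factor_nonzero poly_pderiv_linear_power[of 1 z "- of_real r" "k + m"] by (simp add: d mult_ac)
    ultimately show ?thesis
      by simp
  qed
  have q0: "poly ?q z \<noteq> 0"
    by (rule szego_denominator_nonzero[OF circle_in_disc])
  have "z * eval_fps (fps_deriv (blaschke_szego r k m)) z
      = (z * poly (pderiv ?p) z * poly ?q z - poly ?p z * (z * poly (pderiv ?q) z)) / (poly ?q z)\<^sup>2"
    unfolding blaschke_szego_def eval_deriv_over_denominator[OF circle_in_disc]
    by (simp add: algebra_simps)
  also have "\<dots> = poly ?p z / poly ?q z * (of_nat k / cnj d + of_nat (k + m) * (1 / d - 1))"
  proof -
    have "(a * X * b - a * (- b * Y)) / b\<^sup>2 = a / b * (X + Y)" if "b \<noteq> 0" for a b X Y :: complex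
      using that by (simp add: field_simps power2_eq_square)
    then show ?thesis
      unfolding p q using q0 by blast
  qed
  finally show ?thesis
    unfolding blaschke_szego_def eval_over_denominator[OF circle_in_disc] .
qed

lemma Re_deriv_blaschke_szego_ge:
  "Re (z * eval_fps (fps_deriv (blaschke_szego r k m)) z * cnj (eval_fps (blaschke_szego r k m) z))
     \<ge> real k * (1 - r\<^sup>2) * (1 / cmod d ^ Suc m)\<^sup>2 - real m * (1 / cmod d ^ m)\<^sup>2"
proof -
  let ?f = "eval_fps (blaschke_szego r k m) z"
  have "Re (1 / d) \<ge> 0"
  proof -
    have "0 \<le> (1 - r\<^sup>2) / (cmod d)\<^sup>2"
      using r by (simp add: power_le_one)
    then show ?thesis
      using Re_inverse_szego_factor by linarith
  qed
  have "z * eval_fps (fps_deriv (blaschke_szego r k m)) z * cnj ?f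
      = of_real ((cmod ?f)\<^sup>2) * (of_nat k / cnj d + of_nat (k + m) * (1 / d - 1))"
    unfolding eval_deriv_blaschke_szego complex_norm_square by (simp only: mult_ac)
  then have "Re (z * eval_fps (fps_deriv (blaschke_szego r k m)) z * cnj ?f)
      = (cmod ?f)\<^sup>2 * Re (of_nat k / cnj d + of_nat (k + m) * (1 / d - 1))"
    by (simp only: times_complex.sel Re_complex_of_real Im_complex_of_real mult_zero_left diff_zero)
  also have "Re (of_nat k / cnj d + of_nat (k + m) * (1 / d - 1)) = real k * Re (1 / d) + real (k + m) * (Re (1 / d) - 1)"
  proof -
    have "of_nat k / cnj d = of_real (real k) * cnj (1 / d)"
      by simp
    then show ?thesis
      by (simp only: plus_complex.sel minus_complex.sel) (simp del: complex_cnj_divide)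
  qed
  \<comment> \<open>The terms with \<open>k\<close> combine to Poisson kernels. The others cost at
    most \<open>m\<close> because \<open>Re (1 / d)\<close> is nonnegative, a loss that does not
    grow with \<open>k\<close>.\<close>
  also have "\<dots> = real k * (2 * Re (1 / d) - 1) + real m * (Re (1 / d) - 1)"
    by (simp add: algebra_simps)
  also have "(cmod ?f)\<^sup>2 * \<dots> \<ge> (cmod ?f)\<^sup>2 * (real k * (2 * Re (1 / d) - 1) + real m * (- 1))"
    using \<open>Re (1 / d) \<ge> 0\<close> by (intro mult_left_mono add_left_mono) auto
  also have "(cmod ?f)\<^sup>2 * (real k * (2 * Re (1 / d) - 1) + real m * (- 1)) =
      real k * (1 - r\<^sup>2) * (1 / cmod d ^ Suc m)\<^sup>2 - real m * (1 / cmod d ^ m)\<^sup>2"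
    unfolding cmod_eval_blaschke_szego Re_inverse_szego_factor
    by (simp add: algebra_simps power_divide power_mult_distrib diff_divide_distrib)
  finally show ?thesis .
qed

end

section \<open>Norms of the test functions\<close>

lemma hardy_norm_blaschke_szego: "hardy_norm (blaschke_szego r k m) = hardy_norm (szego_power r m)"
proof -
  have "cmod (eval_fps (blaschke_szego r k m) (cis t)) = cmod (eval_fps (szego_power r m) (cis t))" for t
    using cmod_eval_blaschke_szego[of "cis t", OF _ refl] eval_szego_power[of "cis t" m] szego_radius
    by (simp add: norm_divide norm_power)
  then have "2 * pi * (hardy_norm (blaschke_szego r k m))\<^sup>2 = 2 * pi * (hardy_norm (szego_power r m))\<^sup>2"
    using hardy_norm_integral[OF conv_radius_blaschke_szego, of k m] hardy_norm_integral[OF conv_radius_szego_power, of m]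
    by (simp only:) (rule has_integral_unique)
  then show ?thesis
    using hardy_norm_nonneg[OF conv_radius_blaschke_szego] hardy_norm_nonneg[OF conv_radius_szego_power]
    by (auto simp: power2_eq_iff_nonneg)
qed

lemma bergman_norm_deriv_blaschke_szego_ge:
  "(bergman_norm (fps_deriv (blaschke_szego r k m)))\<^sup>2 \<ge>
     real k * (1 - r\<^sup>2) * (hardy_norm (szego_power r (Suc m)))\<^sup>2 - real m * (hardy_norm (szego_power r m))\<^sup>2"
proof -
  let ?G = "\<lambda>m t. (cmod (eval_fps (szego_power r m) (cis t)))\<^sup>2"
  have "((\<lambda>t. real k * (1 - r\<^sup>2) * ?G (Suc m) t - real m * ?G m t) has_integral
      real k * (1 - r\<^sup>2) * (2 * pi * (hardy_norm (szego_power r (Suc m)))\<^sup>2)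
        - real m * (2 * pi * (hardy_norm (szego_power r m))\<^sup>2)) {0..2*pi}"
    by (intro has_integral_diff has_integral_mult_right hardy_norm_integral conv_radius_szego_power)
  moreover have "((\<lambda>t. Re (cis t * eval_fps (fps_deriv (blaschke_szego r k m)) (cis t)
          * cnj (eval_fps (blaschke_szego r k m) (cis t)))) has_integral
        2 * pi * (bergman_norm (fps_deriv (blaschke_szego r k m)))\<^sup>2) {0..2*pi}"
    by (rule bergman_norm_deriv_integral[OF conv_radius_blaschke_szego])
  moreover have "real k * (1 - r\<^sup>2) * ?G (Suc m) t - real m * ?G m t \<le>
      Re (cis t * eval_fps (fps_deriv (blaschke_szego r k m)) (cis t)
          * cnj (eval_fps (blaschke_szego r k m) (cis t)))" for t
  proof -
    have "?G m t = (1 / cmod (1 - of_real r * cis t) ^ m)\<^sup>2" for m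
      using eval_szego_power[of "cis t" m] szego_radius by (simp add: norm_divide norm_power)
    then show ?thesis
      using Re_deriv_blaschke_szego_ge[of "cis t", OF _ refl, of k m] by (simp only: norm_cis)
  qed
  ultimately have "real k * (1 - r\<^sup>2) * (2 * pi * (hardy_norm (szego_power r (Suc m)))\<^sup>2)
        - real m * (2 * pi * (hardy_norm (szego_power r m))\<^sup>2)
      \<le> 2 * pi * (bergman_norm (fps_deriv (blaschke_szego r k m)))\<^sup>2"
    by (rule has_integral_le)
  then have "2 * pi * (real k * (1 - r\<^sup>2) * (hardy_norm (szego_power r (Suc m)))\<^sup>2 - real m * (hardy_norm (szego_power r m))\<^sup>2)
      \<le> 2 * pi * (bergman_norm (fps_deriv (blaschke_szego r k m)))\<^sup>2"
    by (simp only: right_diff_distrib mult_ac)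
  then show ?thesis
    by (rule mult_left_le_imp_le) simp
qed

text \<open>Otherwise the squared norms would grow at most geometrically with a ratio below
  \<open>1 / (1 - r)\<^sup>2\<close>, contradicting the lower bound that evaluation at a point \<open>\<rho>\<close> near 1 provides.\<close>

lemma szego_power_growth:
  assumes c: "c < (1 + r) / (1 - r)"
  shows "\<exists>m\<ge>1. c * (hardy_norm (szego_power r m))\<^sup>2 < (1 - r\<^sup>2) * (hardy_norm (szego_power r (Suc m)))\<^sup>2"
proof (rule ccontr)
  define N where "N m = (hardy_norm (szego_power r m))\<^sup>2" for m
  define q where "q = c / (1 - r\<^sup>2)"
  have N_pos: "N m > 0" for m
    using hardy_norm_szego_power_pos[of m] by (simp add: N_def)
  have r2: "1 - r\<^sup>2 > 0"
    using r by (simp add: power_less_one_iff abs_square_less_1)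
  assume "\<not> ?thesis"
  then have step: "N (Suc m) \<le> q * N m" if "m \<ge> 1" for m
    using that r2 unfolding N_def[symmetric] by (simp add: q_def not_less field_simps)
  \<comment> \<open>No sign of \<open>c\<close> is given; that \<open>q\<close> is positive follows
    from the negated claim and the positivity of \<open>N\<close>.\<close>
  have "0 < q * N 1"
    using step[of 1] N_pos[of "Suc 1"] by linarith
  then have "q > 0"
    using N_pos[of 1] by (simp add: zero_less_mult_iff)
  have N_le: "N (Suc m) \<le> q ^ m * N 1" for m
  proof (induction m)
    case (Suc m)
    have "N (Suc (Suc m)) \<le> q * N (Suc m)"
      by (rule step) simp
    also have "\<dots> \<le> q * (q ^ m * N 1)"
      using Suc \<open>q > 0\<close> by simp
    finally show ?case
      by (simp add: mult.assoc)
  qed simp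
  have "q < 1 / (1 - r)\<^sup>2"
  proof -
    have "q < (1 + r) / (1 - r) / (1 - r\<^sup>2)"
      unfolding q_def using c r2 by (rule divide_strict_right_mono)
    also have "\<dots> = 1 / (1 - r)\<^sup>2"
    proof -
      have "1 - r\<^sup>2 = (1 + r) * (1 - r)"
        by (simp add: algebra_simps power2_eq_square)
      then show ?thesis
        using r by (simp add: power2_eq_square)
    qed
    finally show ?thesis .
  qed
  \<comment> \<open>By continuity the strict inequality at 1 survives at some \<rho> inside the
    disc, where point evaluation is bounded.\<close>
  moreover have "((\<lambda>\<rho>. 1 / (1 - r * \<rho>)\<^sup>2) \<longlongrightarrow> 1 / (1 - r * 1)\<^sup>2) (at_left 1)"
    using r by (intro tendsto_intros) auto
  ultimately have "\<forall>\<^sub>F \<rho> in at_left 1. q < 1 / (1 - r * \<rho>)\<^sup>2"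
    by (simp add: order_tendstoD)
  moreover have "\<forall>\<^sub>F \<rho> in at_left (1::real). \<rho> \<in> {0<..<1}"
    by (rule eventually_at_left_real) simp
  ultimately have "\<forall>\<^sub>F \<rho> in at_left 1. q < 1 / (1 - r * \<rho>)\<^sup>2 \<and> \<rho> \<in> {0<..<1}"
    by (rule eventually_conj)
  then obtain \<rho> where q_less: "q < 1 / (1 - r * \<rho>)\<^sup>2" and \<rho>: "0 < \<rho>" "\<rho> < 1"
    using eventually_happens[of _ "at_left (1::real)"] by auto
  \<comment> \<open>The square of \<open>szego_power r m\<close> at \<rho> is \<open>x ^ m\<close>,
    so \<open>N\<close> grows at least at rate \<open>x\<close>, which exceeds
    \<open>q\<close>.\<close>
  define x where "x = 1 / (1 - r * \<rho>)\<^sup>2"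
  have N_ge: "x ^ m * (1 - \<rho>)\<^sup>2 \<le> N m" for m
  proof -
    have "r * \<rho> < 1"
      using r \<rho> by (metis mult_le_one less_le mult_less_cancel_left2 mult.commute less_le_trans not_le)
    have ev: "eval_fps (szego_power r m) (of_real \<rho>) = of_real ((1 / (1 - r * \<rho>)) ^ m)"
      using eval_szego_power[of "of_real \<rho>" m] \<rho> szego_radius by (simp add: power_divide)
    have "(1 / (1 - r * \<rho>)) ^ m \<le> hardy_norm (szego_power r m) / (1 - \<rho>)"
      using eval_fps_le_hardy_norm[OF conv_radius_szego_power, of "of_real \<rho>" m] \<rho> \<open>r * \<rho> < 1\<close>
      unfolding ev norm_of_real by simp
    then have "(1 / (1 - r * \<rho>)) ^ m * (1 - \<rho>) \<le> hardy_norm (szego_power r m)"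
      using \<rho> by (simp add: field_simps)
    then have "((1 / (1 - r * \<rho>)) ^ m * (1 - \<rho>))\<^sup>2 \<le> N m"
      unfolding N_def using \<rho> \<open>r * \<rho> < 1\<close> by (intro power_mono) auto
    then show ?thesis
      by (simp add: x_def power_mult_distrib power_divide flip: power_mult) (simp add: mult.commute)
  qed
  have "1 < x / q"
    using q_less \<open>q > 0\<close> unfolding x_def[symmetric] by (simp add: pos_less_divide_eq)
  \<comment> \<open>\<open>N_le\<close> bounds \<open>N (Suc m)\<close> with exponent
    \<open>m\<close>, while \<open>N_ge\<close> gives the exponent \<open>Suc m\<close>; the surplus
    factor \<open>x\<close> joins the constant.\<close>
  then obtain m where m: "N 1 / (x * (1 - \<rho>)\<^sup>2) < (x / q) ^ m"
    using real_arch_pow by blast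
  have "x > 0"
    using q_less \<open>q > 0\<close> unfolding x_def[symmetric] by linarith
  then have "x * (1 - \<rho>)\<^sup>2 > 0"
    using \<rho> by simp
  with m have "N 1 < (x / q) ^ m * (x * (1 - \<rho>)\<^sup>2)"
    by (simp only: pos_divide_less_eq)
  then have "q ^ m * N 1 < q ^ m * ((x / q) ^ m * (x * (1 - \<rho>)\<^sup>2))"
    using \<open>q > 0\<close> by simp
  also have "\<dots> = x ^ Suc m * (1 - \<rho>)\<^sup>2"
    using \<open>q > 0\<close> by (simp add: power_divide)
  also have "\<dots> \<le> N (Suc m)"
    by (rule N_ge)
  finally show False
    using N_le[of m] by simp
qed

section \<open>Two-sided bounds for the constant\<close>

lemma bdd_above_ratios:
  assumes "n \<ge> 1"
  shows "bdd_above {bergman_norm (fps_deriv f) / hardy_norm f | f. f \<in> Rnr n r \<and> f \<noteq> 0}"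
  using bergman_hardy_ratio_le[OF r assms] by (auto intro!: bdd_aboveI)

lemma blaschke_szego_nonzero: "blaschke_szego r k m \<noteq> 0"
proof
  assume "blaschke_szego r k m = 0"
  then have "hardy_norm (szego_power r m) = 0"
    using hardy_norm_blaschke_szego[of k m] by (simp add: hardy_norm_def)
  then show False
    using hardy_norm_szego_power_pos[of m] by simp
qed

lemma C_bergman_hardy_le:
  assumes "n \<ge> 1"
  shows "C_bergman_hardy n r \<le> sqrt (real n * ((1 + r) / (1 - r)))"
proof -
  \<comment> \<open>A nonzero member of the class: \<open>cSup_least\<close> requires a nonempty
    set.\<close>
  have "blaschke_szego r 0 n \<in> Rnr n r"
    using blaschke_szego_in_Rnr[OF assms, of 0] by simp
  then show ?thesis
    unfolding C_bergman_hardy_def using bergman_hardy_ratio_le[OF r assms] blaschke_szego_nonzero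
    by (intro cSup_least) blast+
qed

lemma C_bergman_hardy_ge:
  assumes m: "m \<ge> 1"
  shows "C_bergman_hardy (k + m) r \<ge> sqrt (real k *
     ((1 - r\<^sup>2) * (hardy_norm (szego_power r (Suc m)))\<^sup>2 / (hardy_norm (szego_power r m))\<^sup>2) - real m)"
proof -
  let ?f = "blaschke_szego r k m" and ?H = "hardy_norm (szego_power r m)"
  have H: "?H > 0"
    by (rule hardy_norm_szego_power_pos)
  have "real k * ((1 - r\<^sup>2) * (hardy_norm (szego_power r (Suc m)))\<^sup>2 / ?H\<^sup>2) - real m
      \<le> (bergman_norm (fps_deriv ?f))\<^sup>2 / ?H\<^sup>2"
    using divide_right_mono[OF bergman_norm_deriv_blaschke_szego_ge[of k m], of "?H\<^sup>2"] H
    by (simp add: diff_divide_distrib)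
  \<comment> \<open>For small \<open>k\<close> the radicand may be negative; \<open>sqrt\<close> is
    monotone on all reals, so the comparison still holds.\<close>
  then have "sqrt (real k * ((1 - r\<^sup>2) * (hardy_norm (szego_power r (Suc m)))\<^sup>2 / ?H\<^sup>2) - real m)
      \<le> \<bar>bergman_norm (fps_deriv ?f) / ?H\<bar>"
    by (metis power_divide real_sqrt_abs real_sqrt_le_iff)
  also have "\<dots> = bergman_norm (fps_deriv ?f) / hardy_norm ?f"
    using H by (simp add: hardy_norm_blaschke_szego bergman_norm_deriv_nonneg[OF conv_radius_blaschke_szego])
  also have "\<dots> \<le> C_bergman_hardy (k + m) r"
    unfolding C_bergman_hardy_def
    using m blaschke_szego_in_Rnr[OF m, of k] blaschke_szego_nonzero by (intro cSup_upper bdd_above_ratios) auto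
  finally show ?thesis .
qed

end

theorem theoremA:
  fixes r :: real
  assumes "0 \<le> r" and "r < 1"
  shows "(\<lambda>n. C_bergman_hardy n r / sqrt (real n)) \<longlonglongrightarrow> sqrt ((1 + r) / (1 - r))"
proof (rule order_tendstoI)
  fix a
  assume "sqrt ((1 + r) / (1 - r)) < a"
  moreover have "C_bergman_hardy n r / sqrt (real n) \<le> sqrt ((1 + r) / (1 - r))" if "n \<ge> 1" for n
  proof -
    have "C_bergman_hardy n r \<le> sqrt ((1 + r) / (1 - r)) * sqrt (real n)"
      using C_bergman_hardy_le[OF assms that] by (simp add: real_sqrt_mult mult.commute del: times_divide_eq_right times_divide_eq_left)
    then show ?thesis
      using that by (simp add: pos_divide_le_eq)
  qed
  ultimately show "\<forall>\<^sub>F n in sequentially. C_bergman_hardy n r / sqrt (real n) < a"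
    by (intro eventually_sequentiallyI[of 1]) (meson le_less_trans)
next
  fix a
  assume a: "a < sqrt ((1 + r) / (1 - r))"
  \<comment> \<open>Truncation at 0 allows negative \<open>a\<close>:
    \<open>sqrt c = max a 0\<close> is at least \<open>a\<close> and still below the positive
    limit.\<close>
  define c where "c = (max a 0)\<^sup>2"
  have "sqrt c < sqrt ((1 + r) / (1 - r))"
    using a assms by (simp add: c_def)
  then have "c < (1 + r) / (1 - r)"
    by simp
  from szego_power_growth[OF assms this] obtain m where m: "m \<ge> 1" and
    growth: "c * (hardy_norm (szego_power r m))\<^sup>2 < (1 - r\<^sup>2) * (hardy_norm (szego_power r (Suc m)))\<^sup>2"
    by blast
  define K where "K = (1 - r\<^sup>2) * (hardy_norm (szego_power r (Suc m)))\<^sup>2 / (hardy_norm (szego_power r m))\<^sup>2"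
  have "c < K"
    unfolding K_def using growth hardy_norm_szego_power_pos[OF assms, of m] by (simp add: pos_less_divide_eq)
  \<comment> \<open>Since \<open>m\<close> is fixed, both losses, \<open>k = n - m\<close> in place
    of \<open>n\<close> and the subtracted \<open>m\<close>, vanish after division by
    \<open>n\<close>.\<close>
  have "(\<lambda>n. ((real n - real m) * K - real m) / real n) \<longlonglongrightarrow> K"
    by real_asymp
  then have "\<forall>\<^sub>F n in sequentially. c < ((real n - real m) * K - real m) / real n"
    using \<open>c < K\<close> by (rule order_tendstoD)
  then show "\<forall>\<^sub>F n in sequentially. a < C_bergman_hardy n r / sqrt (real n)"
    using eventually_ge_at_top[of m]
  proof eventually_elim
    case (elim n)
    have "a \<le> sqrt c"
      by (simp add: c_def)
    also have "\<dots> < sqrt (((real n - real m) * K - real m) / real n)"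
      using elim by simp
    also have "\<dots> = sqrt (real (n - m) * K - real m) / sqrt (real n)"
      using elim by (simp add: real_sqrt_divide of_nat_diff)
    also have "\<dots> \<le> C_bergman_hardy n r / sqrt (real n)"
      using C_bergman_hardy_ge[OF assms m, of "n - m"] elim
      by (intro divide_right_mono) (simp_all add: K_def)
    finally show ?case .
  qed
qed

end
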